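(* Let $D$ be a $2$-in-regular digraph, and let $H_1,\dots,H_{13}$ be the thirteen digraphs listed in the context. (i) $D$ admits a $(1,\le 1)$-identifying code if and only if $D$ does not contain any subdigraph isomorphic to $H_1$. (ii) $D$ admits a $(1,\le 2)$-identifying code if and only if $D$ does not contain any subdigraph isomorphic to one of $H_1,\dots,H_{13}$.
   Context: Digraphs have no loops and no multiple arcs, but may contain both arcs $(u,v)$ and $(v,u)$ (a digon). For a vertex $u$, $N^-(u)=\{v:(v,u)\in A\}$ and $N^-[u]=N^-(u)\cup\{u\}$; for a vertex set $U$, $N^-[U]=\bigcup_{u\in U}N^-[u]$. A digraph is $2$-in-regular if $|N^-(u)|=2$ for every vertex $u$. A set $C\subseteq V$ is a $(1,\le\ell)$-identifying code in $D$ if $N^-[X]\cap C\ne N^-[Y]\cap C$ for all distinct $X,Y\subseteq V$ with $1\le|X|,|Y|\le\ell$; $D$ admits such a code if some such $C$ exists. Subdigraphs are not necessarily induced. Differently named vertices in each $H_i$ are distinct. Writing $a\to b$ for the arc $(a,b)$, and $a,b\to c$ for the two arcs $(a,c),(b,c)$, the arc sets are: $H_1$: $x\to y$, $y\to x$, $w\to x$, $w\to y$. $H_2$: $a\to b$, $b\to c$, $c\to a$, $w\to a$, $w\to b$. $H_3$: $a\to b$, $b\to a$, $p\to a$, $q\to b$, $q\to p$. $H_4$: $p,q\to a$; $a,q\to b$; $p,b\to c$. $H_5$: $b,p\to a$; $a,q\to b$; $a,w\to p$; $a,w\to q$. $H_6$: $b,p\to a$; $a,q\to b$; $p,q\to c$.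 $H_7$: $y,y'\to x$; $x,w\to y$; $w,y\to x'$; $x',y\to y'$. $H_8$: $d,w\to a$; $a,w\to b$; $b,w\to c$; $c,w\to d$. $H_9$: $p,q\to a$; $p,q\to b$; $a,b\to c$. $H_{10}$: $b,p\to a$; $a,q\to b$; $v,w\to p$; $v,w\to q$. $H_{11}$: $y,v\to x$; $x,w\to y$; $w,y'\to x'$; $v,x'\to y'$. $H_{12}$: $y',v\to x$; $x,z\to y$; $y,z\to x'$; $x',v\to y'$. $H_{13}$: $y,y'\to x$; $x,w\to y$; $w,w'\to x'$; $w',x'\to y'$. *)

theory Defs
  imports "Graph_Theory.Graph_Theory"
begin

definition in_nbh :: "('a,'b) pre_digraph \<Rightarrow> 'a \<Rightarrow> 'a set" where
  "in_nbh D u = {v. v \<rightarrow>\<^bsub>D\<^esub> u}"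

definition closed_in_nbh :: "('a,'b) pre_digraph \<Rightarrow> 'a \<Rightarrow> 'a set" where
  "closed_in_nbh D u = in_nbh D u \<union> {u}"

definition closed_in_nbh_set :: "('a,'b) pre_digraph \<Rightarrow> 'a set \<Rightarrow> 'a set" where
  "closed_in_nbh_set D U = (\<Union>u\<in>U. closed_in_nbh D u)"

definition two_in_regular :: "('a,'b) pre_digraph \<Rightarrow> bool" where
  "two_in_regular D \<longleftrightarrow> (\<forall>u\<in>verts D. card (in_nbh D u) = 2)"

text \<open>
  Vertex sets may be infinite; the condition \<open>1 \<le> card X\<close> forces \<open>X\<close> to be finite and nonempty.
\<close>

definition identifying_code :: "('a,'b) pre_digraph \<Rightarrow> nat \<Rightarrow> 'a set \<Rightarrow> bool" where
  "identifying_code D l C \<longleftrightarrow>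
     C \<subseteq> verts D \<and>
     (\<forall>X Y. X \<subseteq> verts D \<and> Y \<subseteq> verts D \<and> X \<noteq> Y \<and>
        1 \<le> card X \<and> card X \<le> l \<and> 1 \<le> card Y \<and> card Y \<le> l \<longrightarrow>
        closed_in_nbh_set D X \<inter> C \<noteq> closed_in_nbh_set D Y \<inter> C)"

definition admits_identifying_code :: "('a,'b) pre_digraph \<Rightarrow> nat \<Rightarrow> bool" where
  "admits_identifying_code D l \<longleftrightarrow> (\<exists>C. identifying_code D l C)"

text \<open>The constant \<open>subgraph\<close> does not require the subdigraph to be induced.\<close>

definition contains_subdigraph_iso :: "('a,'b) pre_digraph \<Rightarrow> ('c,'d) pre_digraph \<Rightarrow> bool" where
  "contains_subdigraph_iso D H \<longleftrightarrow> (\<exists>S. subgraph S D \<and> digraph_iso S H)"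

datatype vname = va | vb | vc | vd | vp | vq | vv | vw | vw' | vx | vx' | vy | vy' | vz

text \<open>The digraph with the given arcs whose vertices are the ends of these arcs.\<close>

definition digraph_of_arcs :: "vname rel \<Rightarrow> (vname, vname \<times> vname) pre_digraph" where
  "digraph_of_arcs A = with_proj \<lparr>pverts = Field A, parcs = A\<rparr>"

definition H1 :: "(vname, vname \<times> vname) pre_digraph" where
  "H1 = digraph_of_arcs
     {(vx, vy), (vy, vx), (vw, vx), (vw, vy)}"

definition H2 :: "(vname, vname \<times> vname) pre_digraph" where
  "H2 = digraph_of_arcs
     {(va, vb), (vb, vc), (vc, va), (vw, va), (vw, vb)}"

definition H3 :: "(vname, vname \<times> vname) pre_digraph" where
  "H3 = digraph_of_arcs
     {(va, vb), (vb, va), (vp, va), (vq, vb), (vq, vp)}"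

definition H4 :: "(vname, vname \<times> vname) pre_digraph" where
  "H4 = digraph_of_arcs
     {(vp, va), (vq, va), (va, vb), (vq, vb), (vp, vc), (vb, vc)}"

definition H5 :: "(vname, vname \<times> vname) pre_digraph" where
  "H5 = digraph_of_arcs
     {(vb, va), (vp, va), (va, vb), (vq, vb), (va, vp), (vw, vp), (va, vq), (vw, vq)}"

definition H6 :: "(vname, vname \<times> vname) pre_digraph" where
  "H6 = digraph_of_arcs
     {(vb, va), (vp, va), (va, vb), (vq, vb), (vp, vc), (vq, vc)}"

definition H7 :: "(vname, vname \<times> vname) pre_digraph" where
  "H7 = digraph_of_arcs
     {(vy, vx), (vy', vx), (vx, vy), (vw, vy), (vw, vx'), (vy, vx'), (vx', vy'), (vy, vy')}"

definition H8 :: "(vname, vname \<times> vname) pre_digraph" where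
  "H8 = digraph_of_arcs
     {(vd, va), (vw, va), (va, vb), (vw, vb), (vb, vc), (vw, vc), (vc, vd), (vw, vd)}"

definition H9 :: "(vname, vname \<times> vname) pre_digraph" where
  "H9 = digraph_of_arcs
     {(vp, va), (vq, va), (vp, vb), (vq, vb), (va, vc), (vb, vc)}"

definition H10 :: "(vname, vname \<times> vname) pre_digraph" where
  "H10 = digraph_of_arcs
     {(vb, va), (vp, va), (va, vb), (vq, vb), (vv, vp), (vw, vp), (vv, vq), (vw, vq)}"

definition H11 :: "(vname, vname \<times> vname) pre_digraph" where
  "H11 = digraph_of_arcs
     {(vy, vx), (vv, vx), (vx, vy), (vw, vy), (vw, vx'), (vy', vx'), (vv, vy'), (vx', vy')}"

definition H12 :: "(vname, vname \<times> vname) pre_digraph" where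
  "H12 = digraph_of_arcs
     {(vy', vx), (vv, vx), (vx, vy), (vz, vy), (vy, vx'), (vz, vx'), (vx', vy'), (vv, vy')}"

definition H13 :: "(vname, vname \<times> vname) pre_digraph" where
  "H13 = digraph_of_arcs
     {(vy, vx), (vy', vx), (vx, vy), (vw, vy), (vw, vx'), (vw', vx'), (vw', vy'), (vx', vy')}"

end

theory Submission
  imports Defs
begin

text \<open>
  Write \<open>N u\<close> for the in-neighbourhood and \<open>NC u = insert u (N u)\<close> for the closed one. Enlarging a
  candidate code can only help it to separate vertex sets, so an identifying code exists if and only
  if the whole vertex set is one, that is, if and only if no two distinct vertex sets of the admitted
  sizes have the same closed in-neighbourhood. The theorem thus asks when two such sets exist.

  If an obstruction occurs, two sets of at most two of its vertices do the job. In-degree two means that an arc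
  pattern giving two in-neighbours to a vertex fixes the whole in-neighbourhood of that vertex, and in
  each obstruction the vertices in which the two chosen sets differ are fixed in this way
  (\<open>not_admits_of_indistinguishable_pattern\<close>).

  Conversely, suppose that two sets agree. Equal closed in-neighbourhoods of single vertices \<open>x\<close> and
  \<open>y\<close> force a digon with a common in-neighbour, which is \<open>H1\<close>; this is also what remains when a
  single vertex agrees with a pair, because all closed in-neighbourhoods have three elements.
  Two pairs \<open>{u, x}\<close> and \<open>{u, y}\<close> are treated according to which of \<open>x\<close> and \<open>y\<close> lie in \<open>N u\<close>: whichever
  does not must be covered by the other one, and this determines nearly all of the arcs
  (\<open>obstructed_of_pairs_with_common_vertex\<close>).
  For disjoint pairs \<open>{a, c}\<close> and \<open>{b, d}\<close>, every one of the four vertices has an out-neighbour in the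
  opposite pair. Following such arcs leads to a cycle that alternates between the pairs, so there is
  a digon across the pairs or a directed four-cycle through all four vertices. In both cases the
  vertices of the cycle have one unknown in-neighbour each, and comparing the two unions leaves few
  possibilities (\<open>obstructed_of_disjoint_pairs_with_digon\<close>,
  \<open>obstructed_of_disjoint_pairs_with_four_cycle\<close>). Each of them contains an obstruction.
\<close>

definition obstructed :: "('a,'b) pre_digraph \<Rightarrow> bool" where
  "obstructed D \<longleftrightarrow>
    (\<exists>H \<in> {H1, H2, H3, H4, H5, H6, H7, H8, H9, H10, H11, H12, H13}. contains_subdigraph_iso D H)"

section \<open>Subdigraphs as injective arc-preserving maps\<close>

lemma embedding_of_contains_subdigraph_iso:
  assumes "contains_subdigraph_iso D (digraph_of_arcs A)"
  obtains f where "inj_on f (Field A)" and "\<And>u v. (u, v) \<in> A \<Longrightarrow> f u \<rightarrow>\<^bsub>D\<^esub> f v"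
proof -
  obtain S h where S: "subgraph S D" and h: "pre_digraph.digraph_isomorphism S h"
    and A: "digraph_of_arcs A = app_iso h S"
    using assms unfolding contains_subdigraph_iso_def digraph_iso_def by auto
  interpret S: wf_digraph S using S by (simp add: subgraph_def)
  have verts: "Field A = iso_verts h ` verts S" and arcs: "A = iso_arcs h ` arcs S"
    and tail: "iso_tail h = fst" and head: "iso_head h = snd"
    using arg_cong[OF A, of verts] arg_cong[OF A, of arcs] arg_cong[OF A, of tail]
      arg_cong[OF A, of head]
    by (simp_all add: digraph_of_arcs_def)
  let ?f = "the_inv_into (verts S) (iso_verts h)"
  have inj: "inj_on (iso_verts h) (verts S)"
    using h by (rule S.digraph_isomorphism_inj_on_verts)
  show thesis
  proof
    show "inj_on ?f (Field A)"
      unfolding verts using inj by (rule inj_on_the_inv_into)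
  next
    fix u v assume "(u, v) \<in> A"
    then obtain e where e: "e \<in> arcs S" "iso_arcs h e = (u, v)" using arcs by auto
    have "u = iso_verts h (tail S e)" "v = iso_verts h (head S e)"
      using S.iso_verts_tail[OF h e(1)] S.iso_verts_head[OF h e(1)] e(2) by (simp_all add: tail head)
    then have "?f u = tail S e" "?f v = head S e"
      using the_inv_into_f_f[OF inj] e(1) by simp_all
    moreover have "e \<in> arcs D" "tail S e = tail D e" "head S e = head D e"
      using S e(1) by (auto simp: subgraph_def compatible_def)
    ultimately show "?f u \<rightarrow>\<^bsub>D\<^esub> ?f v"
      by (auto simp: arcs_ends_conv)
  qed
qed

text \<open>
  Here the subdigraph has to be built: one arc of \<open>D\<close> is chosen over each arc of the pattern, and the
  isomorphism is the inverse of the embedding on vertices and of this choice on arcs.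
\<close>

lemma contains_subdigraph_iso_of_embedding:
  assumes wf: "wf_digraph D" and inj: "inj_on f (Field A)"
    and arc: "\<And>u v. (u, v) \<in> A \<Longrightarrow> f u \<rightarrow>\<^bsub>D\<^esub> f v"
  shows "contains_subdigraph_iso D (digraph_of_arcs A)"
proof -
  interpret wf_digraph D by (rule wf)
  have "\<forall>a\<in>A. \<exists>e. e \<in> arcs D \<and> tail D e = f (fst a) \<and> head D e = f (snd a)"
  proof
    fix a assume "a \<in> A"
    then have "f (fst a) \<rightarrow>\<^bsub>D\<^esub> f (snd a)" using arc by simp
    then show "\<exists>e. e \<in> arcs D \<and> tail D e = f (fst a) \<and> head D e = f (snd a)"
      by (auto simp: arcs_ends_conv)
  qed
  then obtain e where e: "\<And>a. a \<in> A \<Longrightarrow> e a \<in> arcs D"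
      "\<And>a. a \<in> A \<Longrightarrow> tail D (e a) = f (fst a)" "\<And>a. a \<in> A \<Longrightarrow> head D (e a) = f (snd a)"
    by (auto dest!: bchoice)
  have ends: "fst a \<in> Field A" "snd a \<in> Field A" if "a \<in> A" for a
    using that by (cases a; auto intro: FieldI1 FieldI2)+
  have inj_e: "inj_on e A"
    by (metis ends e(2,3) inj inj_onD inj_onI prod.expand)
  define S where "S = \<lparr>verts = f ` Field A, arcs = e ` A, tail = tail D, head = head D\<rparr>"
  define h where "h = \<lparr>iso_verts = the_inv_into (Field A) f, iso_arcs = the_inv_into A e,
    iso_head = snd, iso_tail = fst\<rparr>"
  have wf_S: "wf_digraph S"
    by unfold_locales (use ends in \<open>auto simp: S_def e intro!: imageI intro: FieldI1 FieldI2\<close>)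
  have "f ` Field A \<subseteq> verts D"
  proof
    fix x assume "x \<in> f ` Field A"
    then obtain a where "a \<in> A" "x = f (fst a) \<or> x = f (snd a)"
      by (fastforce simp: Field_def)
    then show "x \<in> verts D" using e by (metis head_in_verts tail_in_verts)
  qed
  then have "subgraph S D"
    using wf wf_S by (auto simp: subgraph_def compatible_def S_def e)
  moreover have "pre_digraph.digraph_isomorphism S h"
    unfolding pre_digraph.digraph_isomorphism_def
    using wf_S inj inj_e
    by (auto simp: S_def h_def e ends the_inv_into_f_f inj_on_the_inv_into)
  moreover have "digraph_of_arcs A = app_iso h S"
    using inj inj_e
    by (simp add: digraph_of_arcs_def with_proj_def app_iso_def S_def h_def the_inv_into_onto)
  ultimately show ?thesis
    unfolding contains_subdigraph_iso_def digraph_iso_def by blast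
qed

section \<open>Two-in-regular digraphs\<close>

locale two_in_regular_digraph = loopfree_digraph D for D :: "('a, 'b) pre_digraph" +
  assumes two_in_regular: "two_in_regular D"
begin

abbreviation V :: "'a set" where "V \<equiv> verts D"
abbreviation N :: "'a \<Rightarrow> 'a set" where "N \<equiv> in_nbh D"
abbreviation NC :: "'a \<Rightarrow> 'a set" where "NC \<equiv> closed_in_nbh D"

lemma in_nbhD:
  assumes "v \<in> N u"
  shows "v \<in> V" and "u \<in> V" and "v \<noteq> u"
  using assms no_loops by (auto simp: in_nbh_def arcs_ends_conv)

lemma card_in_nbh: "u \<in> V \<Longrightarrow> card (N u) = 2"
  using two_in_regular by (simp add: two_in_regular_def)

lemma finite_in_nbh: "u \<in> V \<Longrightarrow> finite (N u)"
  using card_in_nbh card.infinite by fastforce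

lemma in_nbh_pair:
  assumes "u \<in> V"
  obtains v w where "N u = {v, w}" "v \<noteq> w" "v \<noteq> u" "w \<noteq> u"
proof -
  obtain v w where "N u = {v, w}" "v \<noteq> w"
    using card_in_nbh[OF assms] by (auto simp: card_2_iff)
  moreover have "v \<in> N u" "w \<in> N u" using calculation by auto
  ultimately show thesis using that in_nbhD by blast
qed

lemma in_nbh_other:
  assumes "v \<in> N u"
  obtains w where "N u = {v, w}" "w \<noteq> v" "w \<noteq> u"
  using assms in_nbhD[OF assms] in_nbh_pair[of u] by (metis doubleton_eq_iff insertE singletonD)

lemma in_nbh_eqI:
  assumes "x \<in> N u" "y \<in> N u" "x \<noteq> y"
  shows "N u = {x, y}"
  using assms by (metis in_nbh_other insertE singletonD)

lemma closed_in_nbh_eq: "NC u = insert u (N u)"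
  by (auto simp: closed_in_nbh_def)

lemma closed_in_nbh_subset: "u \<in> V \<Longrightarrow> NC u \<subseteq> V"
  using in_nbhD by (auto simp: closed_in_nbh_eq)

lemma card_closed_in_nbh: "u \<in> V \<Longrightarrow> card (NC u) = 3"
  using in_nbhD(3)[of u u] by (auto simp: closed_in_nbh_eq card_in_nbh finite_in_nbh card_insert_if)

lemma closed_in_nbh_eqI:
  assumes "u \<in> V" "v \<in> V" "NC u \<subseteq> NC v"
  shows "NC u = NC v"
  using assms card_closed_in_nbh finite_in_nbh
  by (intro card_subset_eq) (auto simp: closed_in_nbh_eq)

section \<open>Obstructions leave two vertex sets indistinguishable\<close>

text \<open>
  For a vertex \<open>z\<close> in exactly one of \<open>X\<close> and \<open>Y\<close> the pattern contains two in-neighbours, and in a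
  2-in-regular digraph these are all in-neighbours of the image of \<open>z\<close>. Vertices in both sets may have
  in-neighbours outside the pattern, but these contribute equally to both closed in-neighbourhoods.
  Hence an equality inside the pattern carries over to the whole digraph.
\<close>

lemma not_admits_of_indistinguishable_pattern:
  assumes "contains_subdigraph_iso D (digraph_of_arcs A)"
    and sub: "X \<union> Y \<subseteq> Field A" and "X \<noteq> Y"
    and "1 \<le> card X" "card X \<le> l" "1 \<le> card Y" "card Y \<le> l"
    and closed: "X \<union> A\<inverse> `` X = Y \<union> A\<inverse> `` Y"
    and two: "\<And>z. z \<in> (X - Y) \<union> (Y - X) \<Longrightarrow> 2 \<le> card (A\<inverse> `` {z})"
  shows "\<not> admits_identifying_code D l"
proof -
  obtain f where inj: "inj_on f (Field A)" and arc: "\<And>u v. (u, v) \<in> A \<Longrightarrow> f u \<in> N (f v)"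
    using embedding_of_contains_subdigraph_iso[OF assms(1)] by (auto simp: in_nbh_def)
  have f_V: "f z \<in> V" if "z \<in> Field A" for z
    using that arc in_nbhD unfolding Field_def by blast
  have N_image: "N (f z) = f ` (A\<inverse> `` {z})" if z: "z \<in> (X - Y) \<union> (Y - X)" for z
  proof -
    have zV: "f z \<in> V" using z sub f_V by blast
    have "A\<inverse> `` {z} \<subseteq> Field A" by (auto intro: FieldI1)
    then have "card (f ` (A\<inverse> `` {z})) = card (A\<inverse> `` {z})"
      using inj by (meson card_image inj_on_subset)
    then have "f ` (A\<inverse> `` {z}) = N (f z)"
      using two[OF z] card_in_nbh[OF zV] arc
      by (intro card_seteq finite_in_nbh zV) auto
    then show ?thesis by simp
  qed
  have image: "closed_in_nbh_set D (f ` Z)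
      = f ` (Z \<union> A\<inverse> `` Z) \<union> (\<Union>z\<in>X \<inter> Y. N (f z))"
    if Z: "Z = X \<or> Z = Y" for Z
  proof -
    have "closed_in_nbh_set D (f ` Z) =
        f ` Z \<union> (\<Union>z\<in>Z - X \<inter> Y. N (f z)) \<union> (\<Union>z\<in>X \<inter> Y. N (f z))"
      using Z by (auto simp: closed_in_nbh_set_def closed_in_nbh_eq)
    also have "(\<Union>z\<in>Z - X \<inter> Y. N (f z)) = (\<Union>z\<in>Z - X \<inter> Y. f ` (A\<inverse> `` {z}))"
      using Z N_image by (intro SUP_cong) auto
    also have "f ` Z \<union> (\<Union>z\<in>Z - X \<inter> Y. f ` (A\<inverse> `` {z})) \<union> (\<Union>z\<in>X \<inter> Y. N (f z))
        = f ` (Z \<union> A\<inverse> `` Z) \<union> (\<Union>z\<in>X \<inter> Y. N (f z))"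
      using Z arc by blast
    finally show ?thesis .
  qed
  have "closed_in_nbh_set D (f ` X) = closed_in_nbh_set D (f ` Y)"
    using image closed by simp
  moreover have "f ` X \<noteq> f ` Y"
    using \<open>X \<noteq> Y\<close> inj sub by (metis inj_on_image_eq_iff le_sup_iff)
  moreover have "card (f ` X) = card X" "card (f ` Y) = card Y"
    using inj sub by (meson card_image inj_on_subset le_sup_iff)+
  moreover have "f ` X \<subseteq> V" "f ` Y \<subseteq> V" using f_V sub by auto
  ultimately show ?thesis
    using assms(4-7) unfolding admits_identifying_code_def identifying_code_def by metis
qed

lemma not_admits_1_of_H1: "contains_subdigraph_iso D H1 \<Longrightarrow> \<not> admits_identifying_code D 1"
  unfolding H1_def
  by (erule not_admits_of_indistinguishable_pattern[where X = "{vx}" and Y = "{vy}"])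
    (auto simp: Image_def Collect_disj_eq)

lemma not_admits_2_of_obstructed:
  assumes "obstructed D"
  shows "\<not> admits_identifying_code D 2"
proof -
  note confuse = not_admits_of_indistinguishable_pattern[where l = 2]
  note compute = Image_def Collect_disj_eq
  consider "contains_subdigraph_iso D H1" | "contains_subdigraph_iso D H2" | "contains_subdigraph_iso D H3" | "contains_subdigraph_iso D H4" | "contains_subdigraph_iso D H5" | "contains_subdigraph_iso D H6" | "contains_subdigraph_iso D H7" | "contains_subdigraph_iso D H8" | "contains_subdigraph_iso D H9" | "contains_subdigraph_iso D H10" | "contains_subdigraph_iso D H11" | "contains_subdigraph_iso D H12" | "contains_subdigraph_iso D H13"
    using assms unfolding obstructed_def by blast
  then show ?thesis
  proof cases
    case 1
    then show ?thesis unfolding H1_def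
      by (rule confuse[where X = "{vx}" and Y = "{vy}"]) (auto simp: compute)
  next
    case 2
    then show ?thesis unfolding H2_def
      by (rule confuse[where X = "{vb, vc}" and Y = "{va, vc}"]) (auto simp: compute)
  next
    case 3
    then show ?thesis unfolding H3_def
      by (rule confuse[where X = "{va, vp}" and Y = "{vb, vp}"]) (auto simp: compute)
  next
    case 4
    then show ?thesis unfolding H4_def
      by (rule confuse[where X = "{va, vc}" and Y = "{vb, vc}"]) (auto simp: compute)
  next
    case 5
    then show ?thesis unfolding H5_def
      by (rule confuse[where X = "{va, vq}" and Y = "{vb, vp}"]) (auto simp: compute)
  next
    case 6
    then show ?thesis unfolding H6_def
      by (rule confuse[where X = "{va, vc}" and Y = "{vb, vc}"]) (auto simp: compute)
  next
    case 7
    then show ?thesis unfolding H7_def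
      by (rule confuse[where X = "{vx, vx'}" and Y = "{vy, vy'}"]) (auto simp: compute)
  next
    case 8
    then show ?thesis unfolding H8_def
      by (rule confuse[where X = "{va, vc}" and Y = "{vb, vd}"]) (auto simp: compute)
  next
    case 9
    then show ?thesis unfolding H9_def
      by (rule confuse[where X = "{va, vc}" and Y = "{vb, vc}"]) (auto simp: compute)
  next
    case 10
    then show ?thesis unfolding H10_def
      by (rule confuse[where X = "{va, vq}" and Y = "{vb, vp}"]) (auto simp: compute)
  next
    case 11
    then show ?thesis unfolding H11_def
      by (rule confuse[where X = "{vx, vx'}" and Y = "{vy, vy'}"]) (auto simp: compute)
  next
    case 12
    then show ?thesis unfolding H12_def
      by (rule confuse[where X = "{vx, vx'}" and Y = "{vy, vy'}"]) (auto simp: compute)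
  next
    case 13
    then show ?thesis unfolding H13_def
      by (rule confuse[where X = "{vx, vx'}" and Y = "{vy, vy'}"]) (auto simp: compute)
  qed
qed

section \<open>Recognising the obstructions\<close>

lemma contains_of_embedding:
  assumes "H = digraph_of_arcs A" and "inj_on f (Field A)" and "\<forall>(u, v)\<in>A. f u \<in> N (f v)"
  shows "contains_subdigraph_iso D H"
  unfolding assms(1)
  using assms(3) by (intro contains_subdigraph_iso_of_embedding[OF wf_digraph assms(2)])
    (auto simp: in_nbh_def)

lemma contains_H1:
  "\<lbrakk>distinct [x, y, w]; {y, w} \<subseteq> N x; {x, w} \<subseteq> N y\<rbrakk> \<Longrightarrow> contains_subdigraph_iso D H1"
  by (rule contains_of_embedding[OF H1_def, where f = "(\<lambda>_. w)(vx := x, vy := y)"])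
    (auto simp: inj_on_def)

lemma obstructed_H1:
  "\<lbrakk>distinct [x, y, w]; {y, w} \<subseteq> N x; {x, w} \<subseteq> N y\<rbrakk> \<Longrightarrow> obstructed D"
  by (drule (2) contains_H1) (simp add: obstructed_def)

lemma obstructedI:
  assumes "H \<in> {H1, H2, H3, H4, H5, H6, H7, H8, H9, H10, H11, H12, H13}"
    and "H = digraph_of_arcs A" and "inj_on f (Field A)" and "\<forall>(u, v)\<in>A. f u \<in> N (f v)"
  shows "obstructed D"
  unfolding obstructed_def using contains_of_embedding[OF assms(2-4)] assms(1) by (rule bexI)

text \<open>
  The remaining rules restate the obstructions as inclusions in in-neighbourhoods, one inclusion for
  each vertex that is the head of an arc.
\<close>

lemma obstructed_H2:
  "\<lbrakk>distinct [a, b, c, w]; {a, w} \<subseteq> N b; {b} \<subseteq> N c; {c, w} \<subseteq> N a\<rbrakk>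
    \<Longrightarrow> obstructed D"
  by (rule obstructedI[OF _ H2_def, where f = "(\<lambda>_. w)(va := a, vb := b, vc := c)"])
    (auto simp: inj_on_def)

lemma obstructed_H3:
  "\<lbrakk>distinct [a, b, p, q]; {a, q} \<subseteq> N b; {b, p} \<subseteq> N a; {q} \<subseteq> N p\<rbrakk>
    \<Longrightarrow> obstructed D"
  by (rule obstructedI[OF _ H3_def, where f = "(\<lambda>_. q)(va := a, vb := b, vp := p)"])
    (auto simp: inj_on_def)

lemma obstructed_H4:
  "\<lbrakk>distinct [a, b, c, p, q]; {p, q} \<subseteq> N a; {a, q} \<subseteq> N b; {p, b} \<subseteq> N c\<rbrakk>
    \<Longrightarrow> obstructed D"
  by (rule obstructedI[OF _ H4_def, where f = "(\<lambda>_. q)(va := a, vb := b, vc := c, vp := p)"])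
    (auto simp: inj_on_def)

lemma obstructed_H5:
  "\<lbrakk>distinct [a, b, p, q, w]; {b, p} \<subseteq> N a; {a, q} \<subseteq> N b; {a, w} \<subseteq> N p; {a, w} \<subseteq> N q\<rbrakk>
    \<Longrightarrow> obstructed D"
  by (rule obstructedI[OF _ H5_def, where f = "(\<lambda>_. w)(va := a, vb := b, vp := p, vq := q)"])
    (auto simp: inj_on_def)

lemma obstructed_H6:
  "\<lbrakk>distinct [a, b, c, p, q]; {b, p} \<subseteq> N a; {a, q} \<subseteq> N b; {p, q} \<subseteq> N c\<rbrakk>
    \<Longrightarrow> obstructed D"
  by (rule obstructedI[OF _ H6_def, where f = "(\<lambda>_. q)(va := a, vb := b, vc := c, vp := p)"])
    (auto simp: inj_on_def)

lemma obstructed_H7: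
  "\<lbrakk>distinct [x, y, x', y', w]; {y, y'} \<subseteq> N x; {x, w} \<subseteq> N y; {w, y} \<subseteq> N x'; {x', y} \<subseteq> N y'\<rbrakk>
    \<Longrightarrow> obstructed D"
  by (rule obstructedI[OF _ H7_def, where f = "(\<lambda>_. w)(vx := x, vy := y, vx' := x', vy' := y')"])
    (auto simp: inj_on_def)

lemma obstructed_H8:
  "\<lbrakk>distinct [a, b, c, d, w]; {d, w} \<subseteq> N a; {a, w} \<subseteq> N b; {b, w} \<subseteq> N c; {c, w} \<subseteq> N d\<rbrakk>
    \<Longrightarrow> obstructed D"
  by (rule obstructedI[OF _ H8_def, where f = "(\<lambda>_. w)(va := a, vb := b, vc := c, vd := d)"])
    (auto simp: inj_on_def)

lemma obstructed_H9:
  "\<lbrakk>distinct [a, b, c, p, q]; {p, q} \<subseteq> N a; {p, q} \<subseteq> N b; {a, b} \<subseteq> N c\<rbrakk>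
    \<Longrightarrow> obstructed D"
  by (rule obstructedI[OF _ H9_def, where f = "(\<lambda>_. q)(va := a, vb := b, vc := c, vp := p)"])
    (auto simp: inj_on_def)

lemma obstructed_H10:
  "\<lbrakk>distinct [a, b, p, q, v, w]; {b, p} \<subseteq> N a; {a, q} \<subseteq> N b; {v, w} \<subseteq> N p; {v, w} \<subseteq> N q\<rbrakk>
    \<Longrightarrow> obstructed D"
  by (rule obstructedI[OF _ H10_def, where f = "(\<lambda>_. w)(va := a, vb := b, vp := p, vq := q, vv := v)"])
    (auto simp: inj_on_def)

lemma obstructed_H11:
  "\<lbrakk>distinct [x, y, x', y', v, w]; {y, v} \<subseteq> N x; {x, w} \<subseteq> N y; {w, y'} \<subseteq> N x'; {v, x'} \<subseteq> N y'\<rbrakk>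
    \<Longrightarrow> obstructed D"
  by (rule obstructedI[OF _ H11_def, where f = "(\<lambda>_. w)(vx := x, vy := y, vx' := x', vy' := y', vv := v)"])
    (auto simp: inj_on_def)

lemma obstructed_H12:
  "\<lbrakk>distinct [x, y, x', y', v, z]; {y', v} \<subseteq> N x; {x, z} \<subseteq> N y; {y, z} \<subseteq> N x'; {x', v} \<subseteq> N y'\<rbrakk>
    \<Longrightarrow> obstructed D"
  by (rule obstructedI[OF _ H12_def, where f = "(\<lambda>_. z)(vx := x, vy := y, vx' := x', vy' := y', vv := v)"])
    (auto simp: inj_on_def)

lemma obstructed_H13:
  "\<lbrakk>distinct [x, y, x', y', w, w']; {y, y'} \<subseteq> N x; {x, w} \<subseteq> N y; {w, w'} \<subseteq> N x'; {w', x'} \<subseteq> N y'\<rbrakk>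
    \<Longrightarrow> obstructed D"
  by (rule obstructedI[OF _ H13_def, where f = "(\<lambda>_. w')(vx := x, vy := y, vx' := x', vy' := y', vw := w)"])
    (auto simp: inj_on_def)

section \<open>Two pairs with a common vertex\<close>

lemma digon_of_equal_closed_in_nbh:
  assumes "x \<in> V" "y \<in> V" "x \<noteq> y" and eq: "NC x = NC y"
  obtains w where "distinct [x, y, w]" "{y, w} \<subseteq> N x" "{x, w} \<subseteq> N y"
proof -
  have "y \<in> N x" using assms by (auto simp: closed_in_nbh_eq)
  then obtain w where w: "N x = {y, w}" "w \<noteq> y" "w \<noteq> x" by (rule in_nbh_other)
  then have "x \<in> N y" "w \<in> N y" using eq assms(3) by (auto simp: closed_in_nbh_eq)
  then show thesis using that[of w] w assms(3) by auto
qed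

text \<open>
  Since \<open>N u = {x, y}\<close>, the in-neighbours of \<open>x\<close> and of \<open>y\<close> outside \<open>{u, x, y}\<close> are the same. The cases
  are how many of the two in-neighbours of \<open>x\<close> lie there, and what the others are.
\<close>

lemma obstructed_both_in_common:
  assumes "x \<in> V" "y \<in> V" "distinct [u, x, y]"
    and eq: "NC x \<union> NC u = NC y \<union> NC u"
    and u: "x \<in> N u" "y \<in> N u"
  shows "obstructed D"
proof -
  have Nu: "N u = {x, y}"
    using in_nbh_eqI[OF u] assms(3) by simp
  have eq_out: "N x - {u, x, y} = N y - {u, x, y}"
    using eq by (auto simp: closed_in_nbh_eq Nu)
  have irrefl: "x \<notin> N x" "y \<notin> N y" using in_nbhD(3) by blast+
  note facts = assms(3) Nu irrefl
  consider "u \<notin> N x" "y \<notin> N x" | "u \<in> N x" "y \<notin> N x" | "u \<notin> N x" "y \<in> N x"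
    | "u \<in> N x" "y \<in> N x" by blast
  then show ?thesis
  proof cases
    case 1
    obtain p q where x: "N x = {p, q}" "p \<noteq> q" using assms(1) by (rule in_nbh_pair)
    have "p \<in> N y" "q \<in> N y" using eq_out x 1 irrefl by auto
    then show ?thesis
      by (intro obstructed_H9[of x y u p q]) (use facts x 1 in auto)
  next
    case 2
    obtain r where x: "N x = {u, r}" "r \<noteq> u" using 2(1) by (rule in_nbh_other)
    have r: "r \<in> N y" "r \<noteq> x" "r \<noteq> y" using eq_out x 2 irrefl by auto
    obtain z where z: "N y = {r, z}" "z \<noteq> r" using r(1) by (rule in_nbh_other)
    have "z = u \<or> z = x" using eq_out x z irrefl by auto
    then show ?thesis
    proof
      assume "z = u"
      then show ?thesis
        by (intro obstructed_H3[of u x y r]) (use facts x r z in auto)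
    next
      assume "z = x"
      then show ?thesis
        by (intro obstructed_H2[of x y u r]) (use facts x r z in auto)
    qed
  next
    case 3
    obtain r where x: "N x = {y, r}" "r \<noteq> y" using 3(2) by (rule in_nbh_other)
    have r: "r \<in> N y" "r \<noteq> x" "r \<noteq> u" using eq_out x 3 irrefl by auto
    obtain z where z: "N y = {r, z}" "z \<noteq> r" using r(1) by (rule in_nbh_other)
    have "z = u \<or> z = x" using eq_out x z irrefl by auto
    then show ?thesis
    proof
      assume "z = u"
      then show ?thesis
        by (intro obstructed_H2[of y x u r]) (use facts x r z in auto)
    next
      assume "z = x"
      then show ?thesis
        by (intro obstructed_H1[of x y r]) (use facts x r z in auto)
    qed
  next
    case 4
    have x: "N x = {u, y}" using in_nbh_eqI[OF 4] assms(3) by auto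
    obtain s t where y: "N y = {s, t}" "s \<noteq> t" using assms(2) by (rule in_nbh_pair)
    have "N y = {u, x}" using eq_out irrefl(2) unfolding x y(1) using y(2) by auto
    then show ?thesis
      by (intro obstructed_H1[of x y u]) (use facts x in auto)
  qed
qed

text \<open>
  Only \<open>N x\<close> can cover \<open>y\<close>, so \<open>y \<rightarrow> x\<close>. The other in-neighbour \<open>s\<close> of \<open>x\<close> is either new, and then it must
  lead to \<open>y\<close> as well, or it lies in \<open>NC u\<close>, and then there is nothing new left for \<open>N y\<close>.
\<close>

lemma obstructed_one_in_common:
  assumes "y \<in> V" "distinct [u, x, y]"
    and eq: "NC x \<union> NC u = NC y \<union> NC u"
    and u: "x \<in> N u" "y \<notin> N u"
  shows "obstructed D"
proof -
  obtain r where Nu: "N u = {x, r}" "r \<noteq> x" "r \<noteq> u" using u(1) by (rule in_nbh_other)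
  have "y \<in> N x" using eq u assms(2) by (auto simp: closed_in_nbh_eq)
  then obtain s where x: "N x = {y, s}" "s \<noteq> y" "s \<noteq> x" by (rule in_nbh_other)
  have r: "r \<noteq> y" using Nu u by auto
  note facts = assms(2) Nu x r
  show ?thesis
  proof (cases "s \<in> {u, r}")
    case False
    then have "s \<in> N y" using eq facts by (auto simp: closed_in_nbh_eq)
    then obtain t where y: "N y = {s, t}" "t \<noteq> s" "t \<noteq> y" by (rule in_nbh_other)
    have "t = x \<or> t = u \<or> t = r" using eq facts y by (auto simp: closed_in_nbh_eq)
    then consider "t = x" | "t = u" | "t = r" by blast
    then show ?thesis
    proof cases
      case 1
      then show ?thesis
        by (intro obstructed_H1[of x y s]) (use False facts y in auto)
    next
      case 2
      then show ?thesis
        by (intro obstructed_H2[of y x u s]) (use False facts y in auto)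
    next
      case 3
      then show ?thesis
        by (intro obstructed_H4[of y x u r s]) (use False facts y in auto)
    qed
  next
    case True
    obtain t t' where y: "N y = {t, t'}" "t \<noteq> t'" "t \<noteq> y" "t' \<noteq> y"
      using assms(1) by (rule in_nbh_pair)
    have "{t, t'} \<subseteq> {u, x, r}"
      using eq True y by (auto simp: closed_in_nbh_eq Nu x)
    then have "u \<in> N y \<and> x \<in> N y \<or> u \<in> N y \<and> r \<in> N y \<or> x \<in> N y \<and> r \<in> N y"
      using y(1,2) by blast
    moreover have "s = u \<or> s = r" using True by simp
    ultimately consider "s = u" "u \<in> N y" "x \<in> N y" | "s = u" "u \<in> N y" "r \<in> N y"
      | "s = u" "x \<in> N y" "r \<in> N y" | "s = r" "u \<in> N y" "x \<in> N y"
      | "s = r" "u \<in> N y" "r \<in> N y" | "s = r" "x \<in> N y" "r \<in> N y"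
      by blast
    then show ?thesis
    proof cases
      case 1
      then show ?thesis by (intro obstructed_H1[of x y u]) (use facts in auto)
    next
      case 2
      then show ?thesis by (intro obstructed_H3[of x u y r]) (use facts in auto)
    next
      case 3
      then show ?thesis by (intro obstructed_H3[of x y u r]) (use facts in auto)
    next
      case 4
      then show ?thesis by (intro obstructed_H3[of y x u r]) (use facts in auto)
    next
      case 5
      then show ?thesis by (intro obstructed_H2[of y x u r]) (use facts in auto)
    next
      case 6
      then show ?thesis by (intro obstructed_H1[of x y r]) (use facts in auto)
    qed
  qed
qed

text \<open>
  Now \<open>x\<close> and \<open>y\<close> can only be covered by each other, so they form a digon. Their other in-neighbours
  coincide or both lie in \<open>NC u\<close>.
\<close>

lemma obstructed_none_in_common:
  assumes "distinct [u, x, y]"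
    and eq: "NC x \<union> NC u = NC y \<union> NC u"
    and u: "x \<notin> N u" "y \<notin> N u"
  shows "obstructed D"
proof -
  have "x \<in> N y" "y \<in> N x" using eq u assms(1) by (auto simp: closed_in_nbh_eq)
  then obtain p q where x: "N x = {y, p}" "p \<noteq> y" "p \<noteq> x" and y: "N y = {x, q}" "q \<noteq> x" "q \<noteq> y"
    by (metis in_nbh_other)
  note facts = assms(1) u x y
  show ?thesis
  proof (cases "p = q")
    case True
    then show ?thesis by (intro obstructed_H1[of x y p]) (use facts in auto)
  next
    case False
    then have "p \<in> NC u" "q \<in> NC u" using eq facts by (auto simp: closed_in_nbh_eq)
    then consider "p = u" "q \<in> N u" | "q = u" "p \<in> N u" | "p \<in> N u" "q \<in> N u" "p \<noteq> u" "q \<noteq> u"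
      using False by (auto simp: closed_in_nbh_eq)
    then show ?thesis
    proof cases
      case 1
      then show ?thesis by (intro obstructed_H3[of x y u q]) (use False facts in auto)
    next
      case 2
      then show ?thesis by (intro obstructed_H3[of y x u p]) (use False facts in auto)
    next
      case 3
      then show ?thesis by (intro obstructed_H6[of x y u p q]) (use False facts in auto)
    qed
  qed
qed

text \<open>
  The case \<open>x = u\<close> or \<open>y = u\<close> is that of a single vertex against a pair.
\<close>

lemma obstructed_of_pairs_with_common_vertex:
  assumes "u \<in> V" "x \<in> V" "y \<in> V" "x \<noteq> y"
    and eq: "NC x \<union> NC u = NC y \<union> NC u"
  shows "obstructed D"
proof -
  have twins: "obstructed D" if "v \<in> V" "w \<in> V" "v \<noteq> w" "NC v \<subseteq> NC w" for v w
    using that digon_of_equal_closed_in_nbh[of v w] closed_in_nbh_eqI[of v w] obstructed_H1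
    by metis
  consider "x = u" | "y = u" | "distinct [u, x, y]" "x \<in> N u" "y \<in> N u"
    | "distinct [u, x, y]" "x \<in> N u" "y \<notin> N u" | "distinct [u, y, x]" "y \<in> N u" "x \<notin> N u"
    | "distinct [u, x, y]" "x \<notin> N u" "y \<notin> N u"
    using assms(4) by auto
  then show ?thesis
  proof cases
    case 1
    then show ?thesis using twins[of y u] assms by auto
  next
    case 2
    then show ?thesis using twins[of x u] assms by auto
  next
    case 3
    then show ?thesis using obstructed_both_in_common[OF assms(2,3)] eq by blast
  next
    case 4
    then show ?thesis using obstructed_one_in_common[OF assms(3)] eq by blast
  next
    case 5
    then show ?thesis using obstructed_one_in_common[OF assms(2)] eq by metis
  next
    case 6
    then show ?thesis using obstructed_none_in_common eq by metis
  qed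
qed

section \<open>Disjoint pairs joined by a digon\<close>

text \<open>
  Let \<open>a\<close> and \<open>b\<close> form the digon, and let \<open>p\<close> and \<open>q\<close> be their other in-neighbours. If \<open>p \<noteq> q\<close>, then \<open>p\<close>
  is covered by \<open>d\<close> and \<open>q\<close> is covered by \<open>c\<close>. The lemmas below distinguish whether \<open>p = d\<close> and whether
  \<open>q = c\<close>. In the first, both hold and the in-neighbours of \<open>c\<close> and of \<open>d\<close> outside \<open>{a, b}\<close> agree, once an
  arc between \<open>c\<close> and \<open>d\<close> is excluded by \<open>H3\<close>.
\<close>

lemma obstructed_digon_both_inside:
  assumes "c \<in> V" "d \<in> V" "distinct [a, b, c, d]"
    and eq: "NC a \<union> NC c = NC b \<union> NC d"
    and a: "N a = {b, d}" and b: "N b = {a, c}"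
  shows "obstructed D"
proof -
  note facts = assms(3) a b
  have irrefl: "c \<notin> N c" "d \<notin> N d" using in_nbhD(3) by blast+
  consider "d \<in> N c" | "c \<in> N d" | "c \<notin> N d" "d \<notin> N c" by blast
  then show ?thesis
  proof cases
    case 1
    then show ?thesis by (intro obstructed_H3[of b a c d]) (use facts in auto)
  next
    case 2
    then show ?thesis by (intro obstructed_H3[of a b d c]) (use facts in auto)
  next
    case 3
    have out: "N c - {a, b} = N d - {a, b}"
      using eq 3 irrefl by (auto simp: closed_in_nbh_eq a b)
    consider "a \<notin> N c" "b \<notin> N c" | "a \<in> N c" "b \<notin> N c" | "a \<notin> N c" "b \<in> N c"
      | "a \<in> N c" "b \<in> N c" by blast
    then show ?thesis
    proof cases
      case 1
      obtain v w where c: "N c = {v, w}" "v \<noteq> w" using assms(1) by (rule in_nbh_pair)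
      have "v \<in> N d" "w \<in> N d" using out c 1 by auto
      then show ?thesis
        by (intro obstructed_H10[of a b d c v w]) (use facts irrefl 1 3 c in auto)
    next
      case 2
      obtain w where c: "N c = {a, w}" "w \<noteq> a" using 2(1) by (rule in_nbh_other)
      have w: "w \<in> N d" "w \<noteq> b" using out c 2 by auto
      obtain z where d: "N d = {w, z}" "z \<noteq> w" using w(1) by (rule in_nbh_other)
      have "z = a \<or> z = b" using out c d by auto
      then show ?thesis
      proof
        assume "z = a"
        then show ?thesis
          by (intro obstructed_H5[of a b d c w]) (use facts irrefl 3 c d w in auto)
      next
        assume "z = b"
        then show ?thesis
          by (intro obstructed_H4[of d a c w b]) (use facts irrefl 3 c d w in auto)
      qed
    next
      case b_only: 3
      obtain w where c: "N c = {b, w}" "w \<noteq> b" using b_only(2) by (rule in_nbh_other)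
      have w: "w \<in> N d" "w \<noteq> a" using out c b_only by auto
      obtain z where d: "N d = {w, z}" "z \<noteq> w" using w(1) by (rule in_nbh_other)
      have "z = a \<or> z = b" using out c d by auto
      then show ?thesis
      proof
        assume "z = a"
        then show ?thesis
          by (intro obstructed_H6[of a d c b w]) (use facts irrefl 3 c d w in auto)
      next
        assume "z = b"
        then show ?thesis
          by (intro obstructed_H5[of b a c d w]) (use facts irrefl 3 c d w in auto)
      qed
    next
      case 4
      then show ?thesis by (intro obstructed_H1[of b c a]) (use facts in auto)
    qed
  qed
qed

text \<open>
  Here \<open>c\<close> can only be covered by \<open>d\<close>, which leaves one unknown in-neighbour \<open>s\<close> of \<open>d\<close> and one unknown
  in-neighbour \<open>t\<close> of \<open>c\<close>. If \<open>s = q\<close>, then \<open>q \<rightarrow> d\<close> completes an \<open>H3\<close>. If \<open>s\<close>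
  is a new vertex, then \<open>t = s\<close>; in the other cases \<open>t\<close> is one of \<open>a\<close>, \<open>b\<close>, \<open>d\<close>.
\<close>

lemma obstructed_digon_one_inside:
  assumes "distinct [a, b, c, d]"
    and eq: "NC a \<union> NC c = NC b \<union> NC d"
    and a: "N a = {b, d}" and b: "N b = {a, q}" and q: "q \<notin> {a, b, c, d}" "q \<in> N c"
  shows "obstructed D"
proof -
  have "c \<in> N d" using eq assms(1) q(1) by (auto simp: closed_in_nbh_eq b)
  then obtain s where d: "N d = {c, s}" "s \<noteq> c" "s \<noteq> d" by (rule in_nbh_other)
  obtain t where c: "N c = {q, t}" "t \<noteq> q" "t \<noteq> c" using q(2) by (rule in_nbh_other)
  note facts = assms(1) a b q(1) c d
  note eq = eq[unfolded closed_in_nbh_eq a b c(1) d(1)]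
  consider "s = q" | "s = a" | "s = b" | "s \<notin> {a, b, c, d, q}" using d by blast
  then show ?thesis
  proof cases
    case 1
    then show ?thesis by (intro obstructed_H3[of a b d q]) (use facts in auto)
  next
    case 2
    then have "t = a \<or> t = b \<or> t = d" using eq c q by auto
    then consider "t = a" | "t = b" | "t = d" by blast
    then show ?thesis
    proof cases
      case 1
      then show ?thesis by (intro obstructed_H5[of a d b c q]) (use facts 2 in auto)
    next
      case 2
      then show ?thesis by (intro obstructed_H3[of d a c b]) (use facts \<open>s = a\<close> in auto)
    next
      case 3
      then show ?thesis by (intro obstructed_H6[of d c b a q]) (use facts 2 in auto)
    qed
  next
    case 3
    then have "t = a \<or> t = b \<or> t = d" using eq c q by auto
    then consider "t = a" | "t = b" | "t = d" by blast
    then show ?thesis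
    proof cases
      case 1
      then show ?thesis by (intro obstructed_H9[of b c d a q]) (use facts 3 in auto)
    next
      case 2
      then show ?thesis by (intro obstructed_H7[of a b c d q]) (use facts 3 in auto)
    next
      case 3
      then show ?thesis by (intro obstructed_H3[of d c b q]) (use facts \<open>s = b\<close> in auto)
    qed
  next
    case 4
    then have "t = s" using eq facts by auto
    then show ?thesis by (intro obstructed_H13[of a b c d q s]) (use facts 4 in auto)
  qed
qed

text \<open>
  If \<open>p\<close> and \<open>q\<close> are both new vertices, then \<open>c\<close> and \<open>d\<close> can only cover each other, and all arcs are
  known. A coincidence \<open>p = c\<close> or \<open>q = d\<close> makes one of \<open>p\<close>, \<open>q\<close> an in-neighbour of the other one, as in \<open>H3\<close>.
\<close>

lemma obstructed_digon_none_inside: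
  assumes "distinct [a, b, c, d]"
    and eq: "NC a \<union> NC c = NC b \<union> NC d"
    and a: "N a = {b, p}" and b: "N b = {a, q}" and "p \<noteq> b" "q \<noteq> a" "p \<noteq> q"
    and p: "p \<in> N d" and q: "q \<in> N c"
  shows "obstructed D"
proof -
  have "p \<in> N a" "q \<in> N b" using a b by simp_all
  then have pq: "p \<noteq> a" "p \<noteq> b" "p \<noteq> d" "q \<noteq> a" "q \<noteq> b" "q \<noteq> c"
    using in_nbhD(3) p q \<open>p \<noteq> b\<close> \<open>q \<noteq> a\<close> by blast+
  show ?thesis
  proof (cases "p = c \<or> q = d")
    case True
    then consider "p = c" | "q = d" by blast
    then show ?thesis
    proof cases
      case 1
      then show ?thesis by (intro obstructed_H3[of a b p q]) (use assms(1) a b \<open>p \<noteq> q\<close> p q pq in auto)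
    next
      case 2
      then show ?thesis by (intro obstructed_H3[of b a q p]) (use assms(1) a b \<open>p \<noteq> q\<close> p q pq in auto)
    qed
  next
    case False
    have "c \<in> NC b \<union> NC d" "d \<in> NC a \<union> NC c"
      using eq by (auto simp: closed_in_nbh_eq)
    then have "c \<in> N d" "d \<in> N c"
      using assms(1) False pq by (auto simp: closed_in_nbh_eq a b)
    then show ?thesis
      by (intro obstructed_H11[of a b c d p q]) (use False assms(1) a b \<open>p \<noteq> q\<close> p q pq in auto)
  qed
qed

lemma obstructed_of_disjoint_pairs_with_digon:
  assumes "c \<in> V" "d \<in> V" "distinct [a, b, c, d]"
    and eq: "NC a \<union> NC c = NC b \<union> NC d"
    and "a \<in> N b" "b \<in> N a"
  shows "obstructed D"
proof -
  obtain p where a: "N a = {b, p}" "p \<noteq> b" "p \<noteq> a" using \<open>b \<in> N a\<close> by (rule in_nbh_other)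
  obtain q where b: "N b = {a, q}" "q \<noteq> a" "q \<noteq> b" using \<open>a \<in> N b\<close> by (rule in_nbh_other)
  show ?thesis
  proof (cases "p = q")
    case True
    then show ?thesis by (intro obstructed_H1[of a b p]) (use assms(3) a b in auto)
  next
    case False
    have "p = d \<or> p \<in> N d" "q = c \<or> q \<in> N c"
      using eq False a b by (auto simp: closed_in_nbh_eq)
    then consider "p = d" "q = c" | "p = d" "q \<noteq> c" "q \<in> N c" | "q = c" "p \<noteq> d" "p \<in> N d"
      | "p \<in> N d" "q \<in> N c" by blast
    then show ?thesis
    proof cases
      case 1
      then show ?thesis using obstructed_digon_both_inside[OF assms(1-4)] a b by blast
    next
      case 2
      then show ?thesis
        using obstructed_digon_one_inside[OF assms(3,4), of q] a b False by blast
    next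
      case 3
      then show ?thesis
        using obstructed_digon_one_inside[of b a d c p] a b False assms(3) eq by auto
    next
      case 4
      then show ?thesis
        using obstructed_digon_none_inside[OF assms(3,4) a(1) b(1) a(2) b(2) False] by blast
    qed
  qed
qed

section \<open>Disjoint pairs joined by a directed four-cycle\<close>

text \<open>
  Besides the arcs of the four-cycle, a vertex of the cycle has one more in-neighbour. Without digons
  across the pairs it is the opposite vertex of the cycle or a vertex off the cycle.
\<close>

lemma obstructed_four_cycle_with_chord:
  assumes "distinct [a, b, c, d]"
    and eq: "NC a \<union> NC c = NC b \<union> NC d"
    and cycle: "a \<in> N b" "b \<in> N c" "c \<in> N d" "d \<in> N a"
    and no_digon: "c \<notin> N b" "d \<notin> N c" "a \<notin> N d"
    and chord: "c \<in> N a"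
  shows "obstructed D"
proof -
  have a: "N a = {d, c}" using in_nbh_eqI[OF cycle(4) chord] assms(1) by auto
  obtain s where b: "N b = {a, s}" "s \<noteq> a" "s \<noteq> b" using cycle(1) by (rule in_nbh_other)
  obtain w where c: "N c = {b, w}" "w \<noteq> b" "w \<noteq> c" using cycle(2) by (rule in_nbh_other)
  obtain t where d: "N d = {c, t}" "t \<noteq> c" "t \<noteq> d" using cycle(3) by (rule in_nbh_other)
  have no: "s \<noteq> c" "w \<noteq> d" "t \<noteq> a" using no_digon b c d by auto
  note facts = assms(1) a b c d no
  note eq = eq[unfolded closed_in_nbh_eq a b(1) c(1) d(1)]
  show ?thesis
  proof (cases "w = a")
    case True
    then have "s = d \<or> t = b" using eq facts by auto
    then show ?thesis
    proof
      assume "s = d"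
      then show ?thesis by (intro obstructed_H3[of c a b d]) (use True facts in auto)
    next
      assume "t = b"
      then show ?thesis by (intro obstructed_H3[of a c d b]) (use True facts in auto)
    qed
  next
    case False
    then have "s = w \<or> t = w" "s = w \<or> s = d" "t = w \<or> t = b" using eq facts by auto
    then consider "s = w" "t = w" | "s = w" "t = b" | "s = d" "t = w" by blast
    then show ?thesis
    proof cases
      case 1
      then show ?thesis by (intro obstructed_H4[of d a b w c]) (use False facts in auto)
    next
      case 2
      then show ?thesis by (intro obstructed_H2[of b c a w]) (use False facts in auto)
    next
      case 3
      then show ?thesis by (intro obstructed_H2[of a b c d]) (use False facts in auto)
    qed
  qed
qed

text \<open>
  The hypotheses are invariant under rotating the cycle, so a chord may be placed anywhere. Without
  chords the four remaining in-neighbours lie off the cycle, and opposite pairs have the same ones: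
  they all coincide (\<open>H8\<close>), or cyclically adjacent vertices share them two by two (\<open>H12\<close>).
\<close>

lemma obstructed_of_disjoint_pairs_with_four_cycle:
  assumes "distinct [a, b, c, d]"
    and eq: "NC a \<union> NC c = NC b \<union> NC d"
    and cycle: "a \<in> N b" "b \<in> N c" "c \<in> N d" "d \<in> N a"
    and no_digon: "b \<notin> N a" "c \<notin> N b" "d \<notin> N c" "a \<notin> N d"
  shows "obstructed D"
proof -
  consider "c \<in> N a" | "d \<in> N b" | "a \<in> N c" | "b \<in> N d"
    | "c \<notin> N a" "d \<notin> N b" "a \<notin> N c" "b \<notin> N d" by blast
  then show ?thesis
  proof cases
    case 1
    then show ?thesis using obstructed_four_cycle_with_chord[of a b c d] assms by blast
  next
    case 2
    then show ?thesis using obstructed_four_cycle_with_chord[of b c d a] assms by auto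
  next
    case 3
    then show ?thesis using obstructed_four_cycle_with_chord[of c d a b] assms by auto
  next
    case 4
    then show ?thesis using obstructed_four_cycle_with_chord[of d a b c] assms by auto
  next
    case 5
    obtain v where a: "N a = {d, v}" "v \<noteq> d" "v \<noteq> a" using cycle(4) by (rule in_nbh_other)
    obtain w where b: "N b = {a, w}" "w \<noteq> a" "w \<noteq> b" using cycle(1) by (rule in_nbh_other)
    obtain v' where c: "N c = {b, v'}" "v' \<noteq> b" "v' \<noteq> c" using cycle(2) by (rule in_nbh_other)
    obtain w' where d: "N d = {c, w'}" "w' \<noteq> c" "w' \<noteq> d" using cycle(3) by (rule in_nbh_other)
    have out: "v \<notin> {a, b, c, d}" "v' \<notin> {a, b, c, d}" "w \<notin> {a, b, c, d}" "w' \<notin> {a, b, c, d}"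
      using a b c d no_digon 5 by auto
    have "{v, v'} = {w, w'}"
      using eq[unfolded closed_in_nbh_eq a(1) b(1) c(1) d(1)] out by auto
    then consider "v' = v" "w = v" "w' = v" | "w = v" "w' = v'" "v \<noteq> v'" | "w' = v" "w = v'" "v \<noteq> v'"
      by (auto simp: doubleton_eq_iff)
    then show ?thesis
    proof cases
      case 1
      then show ?thesis by (intro obstructed_H8[of a b c d v]) (use assms(1) a b c d out in auto)
    next
      case 2
      then show ?thesis by (intro obstructed_H12[of b c d a v v']) (use assms(1) a b c d out in auto)
    next
      case 3
      then show ?thesis by (intro obstructed_H12[of a b c d v v']) (use assms(1) a b c d out in auto)
    qed
  qed
qed

lemma obstructed_of_disjoint_pairs:
  assumes V: "a \<in> V" "b \<in> V" "c \<in> V" "d \<in> V" and distinct: "distinct [a, b, c, d]"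
    and eq: "NC a \<union> NC c = NC b \<union> NC d"
  shows "obstructed D"
proof (cases "\<exists>x\<in>{a, c}. \<exists>y\<in>{b, d}. x \<in> N y \<and> y \<in> N x")
  case True
  then consider "a \<in> N b" "b \<in> N a" | "a \<in> N d" "d \<in> N a" | "c \<in> N b" "b \<in> N c" | "c \<in> N d" "d \<in> N c"
    by blast
  then show ?thesis
  proof cases
    case 1
    then show ?thesis using obstructed_of_disjoint_pairs_with_digon[of c d a b] assms by blast
  next
    case 2
    then show ?thesis using obstructed_of_disjoint_pairs_with_digon[of c b a d] assms by auto
  next
    case 3
    then show ?thesis using obstructed_of_disjoint_pairs_with_digon[of a d c b] assms by auto
  next
    case 4
    then show ?thesis using obstructed_of_disjoint_pairs_with_digon[of a b c d] assms by auto
  qed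
next
  case False
  have arcs: "a \<in> N b \<or> a \<in> N d" "c \<in> N b \<or> c \<in> N d" "b \<in> N a \<or> b \<in> N c" "d \<in> N a \<or> d \<in> N c"
    using eq distinct by (auto simp: closed_in_nbh_eq)
  then consider "a \<in> N b" "b \<in> N c" "c \<in> N d" "d \<in> N a" | "a \<in> N d" "d \<in> N c" "c \<in> N b" "b \<in> N a"
    using False by blast
  then show ?thesis
  proof cases
    case 1
    then show ?thesis
      using obstructed_of_disjoint_pairs_with_four_cycle[of a b c d] assms False by blast
  next
    case 2
    then show ?thesis
      using obstructed_of_disjoint_pairs_with_four_cycle[of a d c b] assms False by auto
  qed
qed

section \<open>Characterisation\<close>

text \<open>
  If there is no code at all, then in particular the whole vertex set fails to be one. Closed
  in-neighbourhoods lie inside the vertex set, so intersecting with it has no effect.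
\<close>

lemma indistinguishable_of_not_admits:
  assumes "\<not> admits_identifying_code D l"
  obtains X Y where "X \<subseteq> V" "Y \<subseteq> V" "X \<noteq> Y" "1 \<le> card X" "card X \<le> l" "1 \<le> card Y" "card Y \<le> l"
    "(\<Union>u\<in>X. NC u) = (\<Union>u\<in>Y. NC u)"
proof -
  have "\<not> identifying_code D l V"
    using assms unfolding admits_identifying_code_def by blast
  then obtain X Y where XY: "X \<subseteq> V" "Y \<subseteq> V" "X \<noteq> Y" "1 \<le> card X" "card X \<le> l" "1 \<le> card Y"
      "card Y \<le> l" and eq: "closed_in_nbh_set D X \<inter> V = closed_in_nbh_set D Y \<inter> V"
    unfolding identifying_code_def by blast
  have "closed_in_nbh_set D Z \<subseteq> V" if "Z \<subseteq> V" for Z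
    using that closed_in_nbh_subset unfolding closed_in_nbh_set_def by blast
  then have "closed_in_nbh_set D X = closed_in_nbh_set D Y" using XY eq by blast
  then show thesis using that XY unfolding closed_in_nbh_set_def by blast
qed

lemma obstructed_of_not_admits_2:
  assumes "\<not> admits_identifying_code D 2"
  shows "obstructed D"
proof -
  obtain X Y where XY: "X \<subseteq> V" "Y \<subseteq> V" "X \<noteq> Y" "1 \<le> card X" "card X \<le> 2" "1 \<le> card Y" "card Y \<le> 2"
    and eq: "(\<Union>u\<in>X. NC u) = (\<Union>u\<in>Y. NC u)"
    using assms by (rule indistinguishable_of_not_admits)
  have pair: "\<exists>u v. Z = {u, v}" if "1 \<le> card Z" "card Z \<le> 2" for Z :: "'a set"
  proof -
    have "card Z = 1 \<or> card Z = 2" using that by linarith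
    then show ?thesis by (metis card_1_singletonE card_2_iff insert_absorb2)
  qed
  obtain a c b d where X: "X = {a, c}" and Y: "Y = {b, d}"
    using pair[of X] pair[of Y] XY by blast
  have V: "a \<in> V" "b \<in> V" "c \<in> V" "d \<in> V" using XY X Y by auto
  have eq: "NC a \<union> NC c = NC b \<union> NC d" using eq X Y by simp
  consider "a = b" "c \<noteq> d" | "a = d" "c \<noteq> b" | "c = b" "a \<noteq> d" | "c = d" "a \<noteq> b"
    | "a = c" "{a, c} \<inter> {b, d} = {}" | "b = d" "{a, c} \<inter> {b, d} = {}" | "distinct [a, b, c, d]"
    using XY(3) X Y by auto
  then show ?thesis
  proof cases
    case 1
    then show ?thesis using obstructed_of_pairs_with_common_vertex[of a c d] V eq by auto
  next
    case 2
    then show ?thesis using obstructed_of_pairs_with_common_vertex[of a c b] V eq by auto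
  next
    case 3
    then show ?thesis using obstructed_of_pairs_with_common_vertex[of c a d] V eq by auto
  next
    case 4
    then show ?thesis using obstructed_of_pairs_with_common_vertex[of c a b] V eq by auto
  next
    case 5
    then have "NC b \<subseteq> NC a" "b \<noteq> a" using eq by auto
    then show ?thesis using obstructed_of_pairs_with_common_vertex[of a b a] V by auto
  next
    case 6
    then have "NC a \<subseteq> NC b" "a \<noteq> b" using eq by auto
    then show ?thesis using obstructed_of_pairs_with_common_vertex[of b a b] V by auto
  next
    case 7
    then show ?thesis using obstructed_of_disjoint_pairs V eq by blast
  qed
qed

lemma contains_H1_of_not_admits_1:
  assumes "\<not> admits_identifying_code D 1"
  shows "contains_subdigraph_iso D H1"
proof -
  obtain X Y where XY: "X \<subseteq> V" "Y \<subseteq> V" "X \<noteq> Y" "1 \<le> card X" "card X \<le> 1" "1 \<le> card Y" "card Y \<le> 1"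
    and eq: "(\<Union>u\<in>X. NC u) = (\<Union>u\<in>Y. NC u)"
    using assms by (rule indistinguishable_of_not_admits)
  obtain x y where "X = {x}" "Y = {y}"
    using XY by (metis card_1_singletonE le_antisym)
  then have "x \<in> V" "y \<in> V" "x \<noteq> y" "NC x = NC y" using XY eq by auto
  then obtain w where "distinct [x, y, w]" "{y, w} \<subseteq> N x" "{x, w} \<subseteq> N y"
    by (rule digon_of_equal_closed_in_nbh)
  then show ?thesis by (rule contains_H1)
qed

end

theorem theorem4:
  fixes D :: "('a, 'b) pre_digraph"
  assumes "loopfree_digraph D"
    and "nomulti_digraph D"
    and "two_in_regular D"
  shows "(admits_identifying_code D 1 \<longleftrightarrow> \<not> contains_subdigraph_iso D H1) \<and>
    (admits_identifying_code D 2 \<longleftrightarrow>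
      \<not> (\<exists>H \<in> {H1, H2, H3, H4, H5, H6, H7, H8, H9, H10, H11, H12, H13}.
            contains_subdigraph_iso D H))"
proof -
  interpret two_in_regular_digraph D
    using assms(1,3) by (simp add: two_in_regular_digraph_def two_in_regular_digraph_axioms_def)
  show ?thesis
    using not_admits_1_of_H1 contains_H1_of_not_admits_1
      not_admits_2_of_obstructed obstructed_of_not_admits_2
    unfolding obstructed_def[symmetric] by blast
qed

end
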